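(* Let $F$ be the cumulative distribution function of the standard member (location $0$, scale $1$) of a location-scale family having a density $f$ that is symmetric about the location, and let $\sigma>0$. Let the prior $\pi$ be a member of a location-scale family with a density that is symmetric about its location. For $\beta\in\mathbb{R}$ let $\delta_\beta(x)=\mathbf{1}\{x>\beta\}$, and let $$r(\pi,\delta_\beta)=\mathbb{E}_{\Delta\sim\pi}\left[-\Delta\, F\!\left(\frac{\Delta-\beta}{\sigma}\right)\right]$$ be its Bayes risk. If $\mathbb{E}_\pi(\Delta)=0$, then $\beta=0$ is a critical point of the Bayes risk, regarded as a function $\beta\mapsto r(\pi,\delta_\beta)$ on $\mathbb{R}$.
   Context: Setting: a real unknown $\Delta$ (the true lift) has prior distribution $\pi$. Given $\Delta$, one observes a real random variable $X$ whose law is the member of the location-scale family with location $\Delta$ and scale $\sigma$ (known), i.e. $\mathbb{P}(X\le x\mid\Delta)=F((x-\Delta)/\sigma)$. The action space is $\{0,1\}$ ($a=1$ means "ship"), and the loss is $L(\Delta,a)=-a\Delta$. A decision rule is a map $\delta$ from observations to $\{0,1\}$. Its risk is $R(\Delta,\delta)=\mathbb{E}[L(\Delta,\delta(X))\mid\Delta]$ and its Bayes risk is $r(\pi,\delta)=\mathbb{E}_{\Delta\sim\pi}[R(\Delta,\delta)]$. For the thresholding rule $\delta_\beta(x)=\mathbf{1}\{x>\beta\}$, symmetry of $f$ gives $R(\Delta,\delta_\beta)=-\Delta F((\Delta-\beta)/\sigma)$. The prior density has the form $\frac1\tau\pi_0\left(\frac{\Delta-\mu}{\tau}\right)$ with location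 $\mu\in\mathbb{R}$, scale $\tau>0$, and standard density $\pi_0$ symmetric about $0$.
   Formalization: "Critical point" means the derivative at 0 is zero or does not exist, since for unbounded densities the Bayes risk can have a cusp at 0; if it is differentiable at 0 the derivative is 0, and for bounded f the derivative is shown to exist and equal 0. *)

theory Defs
  imports "HOL-Probability.Probability"
begin

definition symmetric_density :: "(real \<Rightarrow> real) \<Rightarrow> bool" where
  "symmetric_density f \<longleftrightarrow>
     f \<in> borel_measurable borel \<and> (\<forall>x. 0 \<le> f x) \<and>
     (\<integral>\<^sup>+x. ennreal (f x) \<partial>lborel) = 1 \<and> (\<forall>x. f (- x) = f x)"

text \<open>The member with location \<open>m\<close> and scale \<open>s\<close> of the location-scale family
  whose standard member has density \<open>f\<close>.\<close>

definition location_scale :: "(real \<Rightarrow> real) \<Rightarrow> real \<Rightarrow> real \<Rightarrow> real measure" where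
  "location_scale f m s = density lborel (\<lambda>x. ennreal (1 / s * f ((x - m) / s)))"

text \<open>An action is a Boolean: \<open>True\<close> (ship) stands for 1, \<open>False\<close> for 0.\<close>

definition loss :: "real \<Rightarrow> bool \<Rightarrow> real" where
  "loss \<Delta> a = - of_bool a * \<Delta>"

definition threshold_rule :: "real \<Rightarrow> real \<Rightarrow> bool" where
  "threshold_rule \<beta> x \<longleftrightarrow> x > \<beta>"

definition risk :: "(real \<Rightarrow> real) \<Rightarrow> real \<Rightarrow> real \<Rightarrow> (real \<Rightarrow> bool) \<Rightarrow> real" where
  "risk f \<sigma> \<Delta> \<delta> = (\<integral>x. loss \<Delta> (\<delta> x) \<partial>location_scale f \<Delta> \<sigma>)"

definition bayes_risk :: "(real \<Rightarrow> real) \<Rightarrow> real \<Rightarrow> real measure \<Rightarrow> (real \<Rightarrow> bool) \<Rightarrow> real" where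
  "bayes_risk f \<sigma> \<pi> \<delta> = (\<integral>\<Delta>. risk f \<sigma> \<Delta> \<delta> \<partial>\<pi>)"

text \<open>The usual notion from calculus: the derivative vanishes or does not exist.
  The second case does occur for Bayes risks of thresholding rules, but only if the
  density of the observations is unbounded.\<close>

definition critical_point :: "(real \<Rightarrow> real) \<Rightarrow> real \<Rightarrow> bool" where
  "critical_point g x \<longleftrightarrow> \<not> g differentiable (at x) \<or> (g has_real_derivative 0) (at x)"

text \<open>The location-scale relation for the distribution functions, and the closed forms of
  the risk and the Bayes risk of a thresholding rule.\<close>

lemma emeasure_location_scale:
  assumes f: "symmetric_density f" and s: "s > 0" and A: "A \<in> sets borel"
  shows "emeasure (location_scale f m s) A =
         (\<integral>\<^sup>+x. ennreal (f x) * indicator A (m + s * x) \<partial>lborel)"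
proof -
  have [measurable]: "f \<in> borel_measurable borel" "A \<in> sets borel"
    using f A by (auto simp: symmetric_density_def)
  have "emeasure (location_scale f m s) A =
        (\<integral>\<^sup>+x. ennreal (1 / s * f ((x - m) / s)) * indicator A x \<partial>lborel)"
    unfolding location_scale_def by (subst emeasure_density) auto
  also have "\<dots> = ennreal \<bar>s\<bar> * (\<integral>\<^sup>+x. ennreal (1 / s * f ((m + s * x - m) / s)) *
                      indicator A (m + s * x) \<partial>lborel)"
    using s by (intro nn_integral_real_affine) auto
  also have "\<dots> = (\<integral>\<^sup>+x. ennreal \<bar>s\<bar> * (ennreal (1 / s * f x) * indicator A (m + s * x)) \<partial>lborel)"
    using s by (subst nn_integral_cmult[symmetric]) auto
  also have "\<dots> = (\<integral>\<^sup>+x. ennreal (f x) * indicator A (m + s * x) \<partial>lborel)"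
    using s f by (intro nn_integral_cong)
      (auto simp: symmetric_density_def ennreal_mult[symmetric] mult.assoc[symmetric]
            split: split_indicator)
  finally show ?thesis .
qed

lemma prob_space_location_scale:
  assumes "symmetric_density f" "s > 0"
  shows "prob_space (location_scale f m s)"
proof
  have "emeasure (location_scale f m s) UNIV = 1"
    using assms by (subst emeasure_location_scale) (auto simp: symmetric_density_def)
  then show "emeasure (location_scale f m s) (space (location_scale f m s)) = 1"
    by (simp add: location_scale_def)
qed

lemma cdf_location_scale:
  assumes "symmetric_density f" "s > 0"
  shows "cdf (location_scale f m s) x = cdf (location_scale f 0 1) ((x - m) / s)"
proof -
  have "indicator {..x} (m + s * y) = (indicator {..(x - m) / s} y :: ennreal)" for y
    using assms by (auto simp: field_simps split: split_indicator)
  then have "emeasure (location_scale f m s) {..x} =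
             emeasure (location_scale f 0 1) {..(x - m) / s}"
    using assms by (simp add: emeasure_location_scale)
  then show ?thesis
    by (simp add: cdf_def measure_def)
qed

lemma risk_threshold_rule:
  assumes "symmetric_density f" "\<sigma> > 0"
  shows "risk f \<sigma> \<Delta> (threshold_rule \<beta>) = - \<Delta> * cdf (location_scale f 0 1) ((\<Delta> - \<beta>) / \<sigma>)"
proof -
  interpret prob_space "location_scale f \<Delta> \<sigma>"
    using assms by (rule prob_space_location_scale)
  have [measurable]: "f \<in> borel_measurable borel"
    using assms by (auto simp: symmetric_density_def)
  have "emeasure (location_scale f \<Delta> \<sigma>) {\<beta><..} =
        (\<integral>\<^sup>+x. ennreal (f x) * indicator {\<beta><..} (\<Delta> + \<sigma> * x) \<partial>lborel)"
    using assms by (simp add: emeasure_location_scale)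
  also have "\<dots> = ennreal \<bar>-1\<bar> * (\<integral>\<^sup>+x. ennreal (f (0 + -1 * x)) *
                     indicator {\<beta><..} (\<Delta> + \<sigma> * (0 + -1 * x)) \<partial>lborel)"
    by (intro nn_integral_real_affine) auto
  also have "\<dots> = (\<integral>\<^sup>+x. ennreal (f x) * indicator {..<(\<Delta> - \<beta>) / \<sigma>} x \<partial>lborel)"
    using assms by (auto intro!: nn_integral_cong
      simp: symmetric_density_def field_simps split: split_indicator)
  also have "\<dots> = (\<integral>\<^sup>+x. ennreal (f x) * indicator {..(\<Delta> - \<beta>) / \<sigma>} x \<partial>lborel)"
  proof (rule nn_integral_cong_AE)
    show "AE x in lborel. ennreal (f x) * indicator {..<(\<Delta> - \<beta>) / \<sigma>} x =
            ennreal (f x) * indicator {..(\<Delta> - \<beta>) / \<sigma>} x"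
      using AE_lborel_singleton[of "(\<Delta> - \<beta>) / \<sigma>"]
      by eventually_elim (simp add: indicator_def)
  qed
  also have "\<dots> = emeasure (location_scale f 0 1) {..(\<Delta> - \<beta>) / \<sigma>}"
    using assms by (simp add: emeasure_location_scale)
  finally have *: "measure (location_scale f \<Delta> \<sigma>) {\<beta><..} =
                   cdf (location_scale f 0 1) ((\<Delta> - \<beta>) / \<sigma>)"
    by (simp add: cdf_def measure_def)
  have "risk f \<sigma> \<Delta> (threshold_rule \<beta>) =
        (\<integral>x. (- \<Delta>) * indicator {\<beta><..} x \<partial>location_scale f \<Delta> \<sigma>)"
    unfolding risk_def loss_def threshold_rule_def
    by (intro Bochner_Integration.integral_cong) (auto split: split_indicator)
  also have "\<dots> = - \<Delta> * measure (location_scale f \<Delta> \<sigma>) {\<beta><..}"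
    by (simp add: location_scale_def)
  finally show ?thesis
    by (simp only: *)
qed

lemma bayes_risk_threshold_rule:
  assumes "symmetric_density f" "\<sigma> > 0"
  shows "bayes_risk f \<sigma> \<pi> (threshold_rule \<beta>) =
         (\<integral>\<Delta>. - \<Delta> * cdf (location_scale f 0 1) ((\<Delta> - \<beta>) / \<sigma>) \<partial>\<pi>)"
  unfolding bayes_risk_def using assms by (simp add: risk_threshold_rule)

end

theory Submission
  imports Defs
begin

text \<open>
  A symmetric density makes the mean of the prior equal to its location, so the prior is
  symmetric about \<open>0\<close>. Writing \<open>p\<close> for its density, the Bayes risk at \<open>\<beta>\<close> is the integral
  \<open>r \<beta> = \<integral>x. h x * K (x - \<beta>)\<close> of the odd integrable function \<open>h x = - x * p x\<close> against a
  translate of \<open>K y = F (y / \<sigma>)\<close>. Because \<open>K (- y) = 1 - K y\<close> and \<open>h\<close> has integral \<open>0\<close>,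
  reflecting the variable shows that \<open>r\<close> is even
  (\<open>integral_odd_mult_symmetric_reflect\<close>). An even function either fails to be
  differentiable at \<open>0\<close> or has derivative \<open>0\<close> there, so \<open>0\<close> is a critical point.

  When \<open>f\<close> is bounded, the derivative exists. Then \<open>K\<close> is Lipschitz, with some constant \<open>L\<close>,
  but this alone only gives \<open>r \<beta> - r 0 = O(\<beta>)\<close>. Evenness improves it: it turns the first
  difference of \<open>r\<close> into a second difference, and in the latter one of the two translations
  can be moved onto \<open>h\<close>:
  \<open>2 * (r 0 - r \<beta>) = \<integral>x. (h (x + \<beta>) - h x) * (K (x + \<beta>) - K x)\<close>.
  The right-hand side is at most \<open>L * \<bar>\<beta>\<bar>\<close> times the \<open>L\<^sup>1\<close> distance between \<open>h\<close> and its
  translate by \<open>\<beta>\<close>. As this distance tends to \<open>0\<close> with \<open>\<beta>\<close>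
  (\<open>L1_translation_continuous_integrable\<close>), the difference quotient of \<open>r\<close> at \<open>0\<close> tends to
  \<open>0\<close> (\<open>even_convolution_derivative_0\<close>).
\<close>

section \<open>Continuity of translations in \<open>L\<^sup>1\<close>\<close>

definition L1_modulus :: "(real \<Rightarrow> real) \<Rightarrow> real \<Rightarrow> real" where
  "L1_modulus h t = (\<integral>x. \<bar>h (t + x) - h x\<bar> \<partial>lborel)"

lemma integrable_translate:
  fixes h :: "real \<Rightarrow> real"
  assumes "integrable lborel h"
  shows "integrable lborel (\<lambda>x. h (t + x))"
  using lborel_integrable_real_affine[OF assms, of 1 t] by simp

lemma integral_translate:
  fixes h :: "real \<Rightarrow> real"
  shows "(\<integral>x. h (t + x) \<partial>lborel) = (\<integral>x. h x \<partial>lborel)"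
  using lborel_integral_real_affine[of 1 h t] by simp

lemma integral_reflect:
  fixes h :: "real \<Rightarrow> real"
  shows "(\<integral>x. h (- x) \<partial>lborel) = (\<integral>x. h x \<partial>lborel)"
  using lborel_integral_real_affine[of "-1" h 0] by simp

lemma L1_modulus_nonneg: "0 \<le> L1_modulus h t"
  by (simp add: L1_modulus_def)

lemma L1_modulus_add_le:
  assumes "integrable lborel g" "integrable lborel h"
  shows "L1_modulus (\<lambda>x. g x + h x) t \<le> L1_modulus g t + L1_modulus h t"
proof -
  note [intro] = assms integrable_translate
  have "L1_modulus (\<lambda>x. g x + h x) t
        \<le> (\<integral>x. \<bar>g (t + x) - g x\<bar> + \<bar>h (t + x) - h x\<bar> \<partial>lborel)"
    unfolding L1_modulus_def
    by (intro integral_mono integrable_abs Bochner_Integration.integrable_add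
        Bochner_Integration.integrable_diff) auto
  also have "\<dots> = L1_modulus g t + L1_modulus h t"
    unfolding L1_modulus_def
    by (intro Bochner_Integration.integral_add integrable_abs
        Bochner_Integration.integrable_diff) auto
  finally show ?thesis .
qed

lemma L1_modulus_le_norm:
  assumes "integrable lborel h"
  shows "L1_modulus h t \<le> 2 * (\<integral>x. \<bar>h x\<bar> \<partial>lborel)"
proof -
  note [intro] = assms integrable_translate
  have "L1_modulus h t \<le> (\<integral>x. \<bar>h (t + x)\<bar> + \<bar>h x\<bar> \<partial>lborel)"
    unfolding L1_modulus_def
    by (intro integral_mono integrable_abs Bochner_Integration.integrable_add
        Bochner_Integration.integrable_diff) auto
  also have "\<dots> = (\<integral>x. \<bar>h (t + x)\<bar> \<partial>lborel) + (\<integral>x. \<bar>h x\<bar> \<partial>lborel)"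
    by (intro Bochner_Integration.integral_add integrable_abs) auto
  also have "(\<integral>x. \<bar>h (t + x)\<bar> \<partial>lborel) = (\<integral>x. \<bar>h x\<bar> \<partial>lborel)"
    by (rule integral_translate[of "\<lambda>x. \<bar>h x\<bar>"])
  finally show ?thesis by simp
qed

text \<open>Integrability is part of the notion because the Bochner integral in \<open>L1_modulus\<close> is \<open>0\<close>
  by convention when the integrand is not integrable.\<close>

definition L1_translation_continuous :: "(real \<Rightarrow> real) \<Rightarrow> bool" where
  "L1_translation_continuous h \<longleftrightarrow>
     integrable lborel h \<and> ((L1_modulus h) \<longlongrightarrow> 0) (at 0)"

lemma L1_translation_continuous_add:
  assumes "L1_translation_continuous g" "L1_translation_continuous h"
  shows "L1_translation_continuous (\<lambda>x. g x + h x)"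
proof -
  have "((\<lambda>t. L1_modulus g t + L1_modulus h t) \<longlongrightarrow> 0) (at 0)"
    using assms tendsto_add[of "L1_modulus g" 0 "at 0" "L1_modulus h" 0]
    by (auto simp: L1_translation_continuous_def)
  then have "((\<lambda>t. L1_modulus (\<lambda>x. g x + h x) t) \<longlongrightarrow> 0) (at 0)"
    by (rule Lim_null_comparison[rotated])
       (use assms in \<open>auto simp: L1_translation_continuous_def L1_modulus_nonneg
          intro!: L1_modulus_add_le always_eventually\<close>)
  then show ?thesis
    using assms by (auto simp: L1_translation_continuous_def)
qed

lemma L1_translation_continuous_cmult:
  assumes "L1_translation_continuous h"
  shows "L1_translation_continuous (\<lambda>x. c * h x)"
proof -
  have "L1_modulus (\<lambda>x. c * h x) = (\<lambda>t. \<bar>c\<bar> * L1_modulus h t)"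
    by (simp add: L1_modulus_def[abs_def] abs_mult flip: right_diff_distrib)
  then show ?thesis
    using assms tendsto_mult_right_zero[of "L1_modulus h" "at 0" "\<bar>c\<bar>"]
    by (auto simp: L1_translation_continuous_def)
qed

lemma L1_translation_continuous_sum:
  assumes "\<And>i. i \<in> I \<Longrightarrow> L1_translation_continuous (g i)"
  shows "L1_translation_continuous (\<lambda>x. \<Sum>i\<in>I. g i x)"
  using assms
proof (induction I rule: infinite_finite_induct)
  case (insert i I)
  then show ?case by (auto intro!: L1_translation_continuous_add)
qed (auto simp: L1_translation_continuous_def L1_modulus_def[abs_def])

text \<open>Translations preserve the \<open>L\<^sup>1\<close> norm, so functions close in \<open>L\<^sup>1\<close> have uniformly close
  moduli; dominated convergence turns pointwise approximation into approximation in \<open>L\<^sup>1\<close>.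
  This closure property carries the passage from intervals to Borel sets and from there to
  all integrable functions.\<close>

lemma L1_translation_continuous_dominated_limit:
  assumes s: "\<And>i. L1_translation_continuous (s i)"
    and lim: "\<And>x. (\<lambda>i. s i x) \<longlonglongrightarrow> h x"
    and w: "integrable lborel w" and bound: "\<And>i x. \<bar>s i x\<bar> \<le> w x"
  shows "L1_translation_continuous h"
proof -
  have int_s: "integrable lborel (s i)" for i
    using s by (simp add: L1_translation_continuous_def)
  note [measurable] = borel_measurable_integrable[OF int_s] borel_measurable_integrable[OF w]
  have [measurable]: "h \<in> borel_measurable lborel"
    by (rule borel_measurable_LIMSEQ_real[OF lim]) simp
  have int_h: "integrable lborel h"
    by (rule integrable_dominated_convergence[of _ _ s w]) (use lim w bound in auto)
  have hw: "\<bar>h x\<bar> \<le> w x" for x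
    by (rule LIMSEQ_le_const2[OF tendsto_rabs[OF lim]]) (use bound in auto)
  have "(\<lambda>i. \<integral>x. \<bar>h x - s i x\<bar> \<partial>lborel) \<longlonglongrightarrow> (\<integral>x. 0 \<partial>(lborel :: real measure))"
  proof (rule integral_dominated_convergence[where w="\<lambda>x. 2 * w x"])
    show "(\<lambda>x. 0) \<in> borel_measurable lborel" by simp
    show "(\<lambda>x. \<bar>h x - s i x\<bar>) \<in> borel_measurable lborel" for i by measurable
    show "integrable lborel (\<lambda>x. 2 * w x)" using w by simp
    show "AE x in lborel. (\<lambda>i. \<bar>h x - s i x\<bar>) \<longlonglongrightarrow> 0"
      using tendsto_rabs_zero[OF LIM_zero[OF lim]] by (simp add: abs_minus_commute)
    show "AE x in lborel. norm \<bar>h x - s i x\<bar> \<le> 2 * w x" for i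
    proof (rule AE_I2)
      show "norm \<bar>h x - s i x\<bar> \<le> 2 * w x" for x
        using bound[of i x] hw[of x] by simp
    qed
  qed
  then have L1: "(\<lambda>i. \<integral>x. \<bar>h x - s i x\<bar> \<partial>lborel) \<longlonglongrightarrow> 0" by simp
  have "(L1_modulus h \<longlongrightarrow> 0) (at 0)"
  proof (rule tendstoI)
    fix e :: real assume "e > 0"
    then have "\<forall>\<^sub>F i in sequentially. (\<integral>x. \<bar>h x - s i x\<bar> \<partial>lborel) < e / 4"
      using order_tendstoD(2)[OF L1, of "e/4"] by simp
    then obtain i where i: "(\<integral>x. \<bar>h x - s i x\<bar> \<partial>lborel) < e / 4"
      by (auto simp: eventually_sequentially)
    have "\<forall>\<^sub>F t in at 0. L1_modulus (s i) t < e / 2"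
      using s[of i] \<open>e > 0\<close>
      by (intro order_tendstoD(2)[of _ 0]) (auto simp: L1_translation_continuous_def)
    then show "\<forall>\<^sub>F t in at 0. dist (L1_modulus h t) 0 < e"
    proof eventually_elim
      case (elim t)
      have "L1_modulus h t \<le> L1_modulus (\<lambda>x. h x - s i x) t + L1_modulus (s i) t"
        using L1_modulus_add_le[of "\<lambda>x. h x - s i x" "s i" t] int_s int_h by simp
      also have "L1_modulus (\<lambda>x. h x - s i x) t \<le> 2 * (\<integral>x. \<bar>h x - s i x\<bar> \<partial>lborel)"
        using int_s int_h by (intro L1_modulus_le_norm) simp
      finally show ?case
        using elim i L1_modulus_nonneg[of h t] by simp
    qed
  qed
  with int_h show ?thesis by (simp add: L1_translation_continuous_def)
qed

text \<open>An interval and its translate by \<open>t\<close> differ only within distance \<open>\<bar>t\<bar>\<close> of the two end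
  points, which gives the modulus \<open>4 * \<bar>t\<bar>\<close>.\<close>

lemma L1_translation_continuous_interval:
  "L1_translation_continuous (indicator {a..b})"
proof -
  have le: "L1_modulus (indicator {a..b}) t \<le> 4 * \<bar>t\<bar>" for t
  proof -
    let ?A = "\<lambda>c. indicator {c - \<bar>t\<bar>..c + \<bar>t\<bar>} :: real \<Rightarrow> real"
    have ab: "integrable lborel (indicator {a..b} :: real \<Rightarrow> real)" for a b
      by (intro integrable_real_indicator) (auto simp: emeasure_lborel_Icc_eq)
    note int = ab[of "c - \<bar>t\<bar>" "c + \<bar>t\<bar>" for c]
    have "L1_modulus (indicator {a..b}) t \<le> (\<integral>x. ?A a x + ?A b x \<partial>lborel)"
      unfolding L1_modulus_def
      by (intro integral_mono integrable_abs Bochner_Integration.integrable_diff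
          Bochner_Integration.integrable_add ab integrable_translate)
         (auto split: split_indicator)
    also have "\<dots> = 4 * \<bar>t\<bar>"
      using int by simp
    finally show ?thesis .
  qed
  have "((\<lambda>t::real. 4 * \<bar>t\<bar>) \<longlongrightarrow> 0) (at 0)"
    by (intro tendsto_mult_right_zero tendsto_rabs_zero tendsto_ident_at)
  then have "(L1_modulus (indicator {a..b}) \<longlongrightarrow> 0) (at 0)"
  proof (rule Lim_null_comparison[rotated])
    show "\<forall>\<^sub>F t in at 0. norm (L1_modulus (indicator {a..b}) t) \<le> 4 * \<bar>t\<bar>"
      using le L1_modulus_nonneg by (intro always_eventually) simp
  qed
  moreover have "integrable lborel (indicator {a..b} :: real \<Rightarrow> real)"
    by (intro integrable_real_indicator) (auto simp: emeasure_lborel_Icc_eq)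
  ultimately show ?thesis
    by (simp add: L1_translation_continuous_def)
qed

text \<open>Closed intervals form an intersection-stable generator of the Borel sets. The sets are cut
  off by a fixed bounded interval so that complements still have finite measure and the
  indicator of that interval dominates all partial unions.\<close>

lemma L1_translation_continuous_bounded_borel:
  fixes A :: "real set"
  assumes "A \<in> sets borel"
  shows "L1_translation_continuous (indicator (A \<inter> {c..d}))"
proof -
  let ?G = "range (\<lambda>(a, b). {a..b :: real})"
  have "Int_stable ?G"
    by (auto simp: Int_stable_def)
  moreover have "?G \<subseteq> Pow UNIV" by simp
  moreover have "A \<in> sigma_sets UNIV ?G"
    using assms by (simp add: borel_eq_atLeastAtMost)
  ultimately show ?thesis
  proof (induction rule: sigma_sets_induct_disjoint)
    case (basic A)
    then show ?case
      by (auto simp: L1_translation_continuous_interval)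
  next
    case empty
    show ?case
      using L1_translation_continuous_interval[of 1 0] by (simp add: indicator_def[abs_def])
  next
    case (compl A)
    have *: "indicator ((UNIV - A) \<inter> {c..d}) =
          (\<lambda>x. indicator {c..d} x + (-1) * indicator (A \<inter> {c..d}) x :: real)"
      by (auto split: split_indicator)
    show ?case
      unfolding *
      by (intro L1_translation_continuous_add L1_translation_continuous_cmult
          L1_translation_continuous_interval compl)
  next
    case (union A)
    let ?s = "\<lambda>n x. \<Sum>i<n. indicator (A i \<inter> {c..d}) x :: real"
    have s: "?s n x = indicator (\<Union>i<n. A i \<inter> {c..d}) x" for n x
    proof -
      have "disjoint_family_on (\<lambda>i. A i \<inter> {c..d}) {..<n}"
        using union by (auto simp: disjoint_family_on_def)
      then have "indicator (\<Union>i<n. A i \<inter> {c..d}) x = ?s n x"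
        by (intro indicator_UN_disjoint) auto
      then show ?thesis
        by (rule sym)
    qed
    show ?case
    proof (rule L1_translation_continuous_dominated_limit[where s = ?s and w="indicator {c..d}"])
      show "L1_translation_continuous (?s n)" for n
        using union by (intro L1_translation_continuous_sum) auto
      show "(\<lambda>n. ?s n x) \<longlonglongrightarrow> indicator (\<Union> (range A) \<inter> {c..d}) x" for x
      proof -
        have "(\<lambda>n. indicator (\<Union>i<n. A i \<inter> {c..d}) x :: real)
              \<longlonglongrightarrow> indicator (\<Union>i. A i \<inter> {c..d}) x"
          by (rule LIMSEQ_indicator_UN)
        then show ?thesis
          unfolding s by simp
      qed
      show "\<bar>?s n x\<bar> \<le> indicator {c..d} x" for n x
        unfolding s by (auto split: split_indicator)
      show "integrable lborel (indicator {c..d} :: real \<Rightarrow> real)"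
        using L1_translation_continuous_interval by (simp add: L1_translation_continuous_def)
    qed
  qed
qed

lemma L1_translation_continuous_integrable:
  assumes "integrable lborel h"
  shows "L1_translation_continuous h"
  using assms
proof induction
  case (base A c)
  then have A: "A \<in> sets borel" "emeasure lborel A < \<infinity>" by auto
  have "L1_translation_continuous (indicator A)"
  proof (rule L1_translation_continuous_dominated_limit
        [where s="\<lambda>n. indicator (A \<inter> {-real n..real n})" and w="indicator A"])
    show "L1_translation_continuous (indicator (A \<inter> {-real n..real n}))" for n
      by (rule L1_translation_continuous_bounded_borel) fact
    show "(\<lambda>n. indicator (A \<inter> {-real n..real n}) x) \<longlonglongrightarrow> (indicator A x :: real)" for x
    proof (rule tendsto_eventually)
      obtain N where "\<bar>x\<bar> \<le> real N" using real_arch_simple by blast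
      then show "\<forall>\<^sub>F n in sequentially. indicator (A \<inter> {-real n..real n}) x = (indicator A x :: real)"
        by (intro eventually_sequentiallyI[of N]) (auto split: split_indicator)
    qed
    show "integrable lborel (indicator A :: real \<Rightarrow> real)"
      using A by (intro integrable_real_indicator) auto
  qed (auto split: split_indicator)
  from L1_translation_continuous_cmult[OF this, of c] show ?case
    by (simp add: mult.commute)
next
  case (add f g)
  then show ?case by (intro L1_translation_continuous_add)
next
  case (lim f s)
  show ?case
  proof (rule L1_translation_continuous_dominated_limit[where s=s and w="\<lambda>x. 2 * \<bar>f x\<bar>"])
    show "L1_translation_continuous (s i)" for i by fact
    show "(\<lambda>i. s i x) \<longlonglongrightarrow> f x" for x using lim(2) by simp
    show "integrable lborel (\<lambda>x. 2 * \<bar>f x\<bar>)" using lim(4) by simp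
    show "\<bar>s i x\<bar> \<le> 2 * \<bar>f x\<bar>" for i x using lim(3)[of x i] by simp
  qed
qed

section \<open>Differentiability of an even convolution at the origin\<close>

text \<open>The estimate uses the second difference of the integral \<open>r\<close> at \<open>0\<close> with steps \<open>\<beta>\<close> and
  \<open>- \<beta>\<close>. By evenness it equals \<open>2 * (r 0 - r \<beta>)\<close>; as an integral it is a product of a
  difference of \<open>h\<close>, which is small in \<open>L\<^sup>1\<close>, and a difference of \<open>K\<close>, which is uniformly of
  order \<open>\<beta>\<close>.\<close>

lemma even_convolution_derivative_0:
  fixes h K :: "real \<Rightarrow> real"
  assumes h: "integrable lborel h"
    and K: "K \<in> borel_measurable borel" "\<And>x. \<bar>K x\<bar> \<le> B"
    and lipschitz: "\<And>x y. \<bar>K x - K y\<bar> \<le> L * \<bar>x - y\<bar>"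
    and even: "\<And>\<beta>. (\<integral>x. h x * K (x + \<beta>) \<partial>lborel) = (\<integral>x. h x * K (x - \<beta>) \<partial>lborel)"
  shows "((\<lambda>\<beta>. \<integral>x. h x * K (x - \<beta>) \<partial>lborel) has_real_derivative 0) (at 0)"
proof -
  define r where "r \<beta> = (\<integral>x. h x * K (x - \<beta>) \<partial>lborel)" for \<beta>
  note [measurable] = K(1) borel_measurable_integrable[OF h]
  have int: "integrable lborel (\<lambda>x. g x * K (x + c))"
    if g: "integrable lborel g" for g :: "real \<Rightarrow> real" and c
  proof (rule Bochner_Integration.integrable_bound[where f="\<lambda>x. B * g x"])
    note [measurable] = borel_measurable_integrable[OF g]
    show "(\<lambda>x. g x * K (x + c)) \<in> borel_measurable lborel" by measurable
    have "\<bar>g x\<bar> * \<bar>K (x + c)\<bar> \<le> \<bar>g x\<bar> * \<bar>B\<bar>" for x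
      using K(2)[of "x + c"] by (intro mult_left_mono) auto
    then show "AE x in lborel. norm (g x * K (x + c)) \<le> norm (B * g x)"
      by (simp add: abs_mult mult.commute)
  qed (use g in simp)
  have second_diff: "2 * \<bar>r \<beta> - r 0\<bar> \<le> L * \<bar>\<beta>\<bar> * L1_modulus h \<beta>" for \<beta>
  proof -
    let ?D = "\<lambda>x. (h (\<beta> + x) - h x) * (K (x + \<beta>) - K x)"
    have int4: "integrable lborel (\<lambda>x. h (\<beta> + x) * K (x + \<beta>))"
        "integrable lborel (\<lambda>x. h (\<beta> + x) * K x)"
        "integrable lborel (\<lambda>x. h x * K (x + \<beta>))" "integrable lborel (\<lambda>x. h x * K x)"
      using int[OF h, of 0] int[OF h, of \<beta>] int[OF integrable_translate[OF h], of \<beta> \<beta>]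
        int[OF integrable_translate[OF h], of \<beta> 0] by simp_all
    have D: "?D = (\<lambda>x. (h (\<beta> + x) * K (x + \<beta>) - h (\<beta> + x) * K x)
                  - (h x * K (x + \<beta>) - h x * K x))"
      by (auto simp: algebra_simps)
    have "(\<integral>x. ?D x \<partial>lborel) =
          ((\<integral>x. h (\<beta> + x) * K (x + \<beta>) \<partial>lborel) - (\<integral>x. h (\<beta> + x) * K x \<partial>lborel)) -
          ((\<integral>x. h x * K (x + \<beta>) \<partial>lborel) - (\<integral>x. h x * K x \<partial>lborel))"
      unfolding D using int4 by simp
    \<comment> \<open>The four terms are, up to a translation of the variable, \<open>r 0\<close>, \<open>r \<beta>\<close>, \<open>r (- \<beta>)\<close> and
      \<open>r 0\<close>.\<close>
    also have "(\<integral>x. h (\<beta> + x) * K (x + \<beta>) \<partial>lborel) = r 0"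
      using integral_translate[of "\<lambda>x. h x * K x" \<beta>] by (simp add: r_def add.commute)
    also have "(\<integral>x. h (\<beta> + x) * K x \<partial>lborel) = r \<beta>"
      using integral_translate[of "\<lambda>x. h x * K (x - \<beta>)" \<beta>] by (simp add: r_def)
    also have "(\<integral>x. h x * K (x + \<beta>) \<partial>lborel) = r \<beta>"
      using even by (simp add: r_def)
    also have "(\<integral>x. h x * K x \<partial>lborel) = r 0"
      by (simp add: r_def)
    finally have D_eq: "(\<integral>x. ?D x \<partial>lborel) = r 0 - r \<beta> - (r \<beta> - r 0)" .
    have "2 * \<bar>r \<beta> - r 0\<bar> = \<bar>\<integral>x. ?D x \<partial>lborel\<bar>"
      unfolding D_eq by (simp add: abs_if)
    also have "\<dots> \<le> (\<integral>x. \<bar>?D x\<bar> \<partial>lborel)"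
      by (rule integral_abs_bound)
    also have "\<dots> \<le> (\<integral>x. L * \<bar>\<beta>\<bar> * \<bar>h (\<beta> + x) - h x\<bar> \<partial>lborel)"
    proof (rule integral_mono)
      show "integrable lborel (\<lambda>x. \<bar>?D x\<bar>)"
      proof (rule integrable_abs)
        show "integrable lborel ?D"
          unfolding D by (intro Bochner_Integration.integrable_diff int4)
      qed
      show "integrable lborel (\<lambda>x. L * \<bar>\<beta>\<bar> * \<bar>h (\<beta> + x) - h x\<bar>)"
        using h integrable_translate[OF h] by simp
      show "\<bar>?D x\<bar> \<le> L * \<bar>\<beta>\<bar> * \<bar>h (\<beta> + x) - h x\<bar>" for x
        using mult_left_mono[OF lipschitz[of "x + \<beta>" x], of "\<bar>h (\<beta> + x) - h x\<bar>"]
        by (simp add: abs_mult mult_ac)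
    qed
    also have "\<dots> = L * \<bar>\<beta>\<bar> * L1_modulus h \<beta>"
      by (simp add: L1_modulus_def)
    finally show ?thesis .
  qed
  have "((\<lambda>\<beta>. L / 2 * L1_modulus h \<beta>) \<longlongrightarrow> 0) (at 0)"
    using L1_translation_continuous_integrable[OF h]
    by (intro tendsto_mult_right_zero) (simp add: L1_translation_continuous_def)
  then have "((\<lambda>\<beta>. (r (0 + \<beta>) - r 0) / \<beta>) \<longlongrightarrow> 0) (at 0)"
  proof (rule Lim_null_comparison[rotated])
    show "\<forall>\<^sub>F \<beta> in at 0. norm ((r (0 + \<beta>) - r 0) / \<beta>) \<le> L / 2 * L1_modulus h \<beta>"
      unfolding eventually_at_filter
      using second_diff by (intro always_eventually) (auto simp: field_simps)
  qed
  then show ?thesis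
    by (simp add: DERIV_def r_def)
qed

section \<open>Critical points of even functions\<close>

lemma even_derivative_0:
  fixes g :: "real \<Rightarrow> real"
  assumes even: "\<And>x. g (- x) = g x" and deriv: "(g has_real_derivative D) (at 0)"
  shows "D = 0"
proof -
  have "((\<lambda>x. g (- x)) has_real_derivative - D) (at 0)"
    using DERIV_mirror[of g D 0] deriv by simp
  then have "(g has_real_derivative - D) (at 0)"
    by (simp only: even)
  from DERIV_unique[OF deriv this] show ?thesis
    by simp
qed

lemma critical_point_even:
  assumes "\<And>x. g (- x) = g x"
  shows "critical_point g 0"
  using even_derivative_0[of g, OF assms] by (auto simp: critical_point_def real_differentiable_def)

section \<open>Location-scale families with symmetric density\<close>

text \<open>With location and scale \<open>1\<close>, the closed form of the risk of the threshold \<open>1 + x\<close> is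
  \<open>- F (- x)\<close>. Computed directly, the same risk is minus the probability of exceeding
  \<open>1 + x\<close>, that is \<open>- (1 - F x)\<close>. Location \<open>1\<close> serves only to make the loss nonzero.\<close>

lemma cdf_symmetric:
  assumes "symmetric_density f"
  shows "cdf (location_scale f 0 1) (- x) = 1 - cdf (location_scale f 0 1) x"
proof -
  interpret prob_space "location_scale f 1 1"
    using assms by (intro prob_space_location_scale) auto
  have "- cdf (location_scale f 0 1) (- x) = risk f 1 1 (threshold_rule (1 + x))"
    using assms by (simp add: risk_threshold_rule)
  also have "\<dots> = (\<integral>y. - indicator {1 + x<..} y \<partial>location_scale f 1 1)"
    unfolding risk_def loss_def threshold_rule_def
    by (intro Bochner_Integration.integral_cong) (auto split: split_indicator)
  also have "\<dots> = - measure (location_scale f 1 1) {1 + x<..}"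
    by (simp add: location_scale_def)
  also have "{1 + x<..} = space (location_scale f 1 1) - {..1 + x}"
    by (auto simp: location_scale_def)
  also have "measure (location_scale f 1 1) \<dots> = 1 - cdf (location_scale f 1 1) (1 + x)"
    unfolding cdf_def by (rule prob_compl) (simp add: location_scale_def)
  also have "cdf (location_scale f 1 1) (1 + x) = cdf (location_scale f 0 1) x"
    using assms by (simp add: cdf_location_scale[of f 1 1])
  finally show ?thesis by simp
qed

lemma cdf_lipschitz:
  assumes f: "symmetric_density f" and M: "\<And>x. f x \<le> M"
  shows "\<bar>cdf (location_scale f 0 1) x - cdf (location_scale f 0 1) y\<bar> \<le> M * \<bar>x - y\<bar>"
proof -
  interpret prob_space "location_scale f 0 1"
    using f by (intro prob_space_location_scale) auto
  interpret finite_borel_measure "location_scale f 0 1"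
    by unfold_locales (simp add: location_scale_def)
  have "0 \<le> M"
    using f M[of 0] by (auto simp: symmetric_density_def intro: order_trans)
  have le: "0 \<le> cdf (location_scale f 0 1) v - cdf (location_scale f 0 1) u \<and>
        cdf (location_scale f 0 1) v - cdf (location_scale f 0 1) u \<le> M * (v - u)"
    if "u < v" for u v
  proof -
    have "emeasure (location_scale f 0 1) {u<..v} =
          (\<integral>\<^sup>+x. ennreal (f x) * indicator {u<..v} x \<partial>lborel)"
      using f by (simp add: emeasure_location_scale)
    also have "\<dots> \<le> (\<integral>\<^sup>+x. ennreal M * indicator {u<..v} x \<partial>lborel)"
      using M by (intro nn_integral_mono mult_right_mono ennreal_leI) auto
    also have "\<dots> = ennreal (M * (v - u))"
      using that \<open>0 \<le> M\<close> by (simp add: nn_integral_cmult ennreal_mult)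
    finally have "measure (location_scale f 0 1) {u<..v} \<le> M * (v - u)"
      using that \<open>0 \<le> M\<close> by (simp add: emeasure_eq_measure)
    then show ?thesis
      using cdf_diff_eq[OF that] by simp
  qed
  show ?thesis
    using le[of x y] le[of y x] by (cases x y rule: linorder_cases) auto
qed

lemma cdf_location_scale_measurable:
  assumes "symmetric_density f"
  shows "cdf (location_scale f 0 1) \<in> borel_measurable borel"
proof -
  interpret prob_space "location_scale f 0 1"
    using assms by (intro prob_space_location_scale) auto
  interpret finite_borel_measure "location_scale f 0 1"
    by unfold_locales (simp add: location_scale_def)
  show ?thesis
    by (rule borel_measurable_mono) (auto simp: mono_def intro: cdf_nondecreasing)
qed

lemma integral_location_scale:
  assumes p: "symmetric_density p" and "s > 0" and g: "g \<in> borel_measurable borel"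
  shows "(\<integral>x. g x \<partial>location_scale p m s) = (\<integral>x. 1 / s * p ((x - m) / s) * g x \<partial>lborel)"
    and "integrable (location_scale p m s) g \<longleftrightarrow>
           integrable lborel (\<lambda>x. 1 / s * p ((x - m) / s) * g x)"
  using assms unfolding location_scale_def symmetric_density_def
  by (subst integral_real_density integrable_real_density; auto)+

text \<open>After centring at \<open>m\<close> the integrand is odd.\<close>

lemma expectation_location_scale:
  assumes p: "symmetric_density p" and s: "s > 0"
    and int: "integrable (location_scale p m s) (\<lambda>x. x)"
  shows "(\<integral>x. x \<partial>location_scale p m s) = m"
proof -
  interpret prob_space "location_scale p m s"
    using p s by (rule prob_space_location_scale)
  let ?q = "\<lambda>x. 1 / s * p (x / s) * x"
  have "(\<integral>x. x - m \<partial>location_scale p m s) =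
        (\<integral>x. 1 / s * p ((x - m) / s) * (x - m) \<partial>lborel)"
    by (rule integral_location_scale[OF p s]) simp
  also have "\<dots> = (\<integral>x. ?q x \<partial>lborel)"
    using integral_translate[of ?q "- m"] by simp
  finally have *: "(\<integral>x. x - m \<partial>location_scale p m s) = (\<integral>x. ?q x \<partial>lborel)" .
  have "?q (- x) = - ?q x" for x
    using p by (simp add: symmetric_density_def)
  then have "(\<integral>x. ?q (- x) \<partial>lborel) = - (\<integral>x. ?q x \<partial>lborel)"
    by (simp only: Bochner_Integration.integral_minus)
  then have "(\<integral>x. ?q x \<partial>lborel) = 0"
    using integral_reflect[of ?q] by linarith
  moreover have "(\<integral>x. x - m \<partial>location_scale p m s) = (\<integral>x. x \<partial>location_scale p m s) - m"
    using int by (simp add: prob_space)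
  ultimately show ?thesis
    using * by linarith
qed

section \<open>The Bayes risk of a thresholding rule\<close>

text \<open>Substituting \<open>- x\<close> replaces \<open>h x * K (x + \<beta>)\<close> by \<open>- h x * (1 - K (x - \<beta>))\<close>, and the
  constant \<open>1\<close> contributes nothing because an odd function has integral \<open>0\<close>.\<close>

lemma integral_odd_mult_symmetric_reflect:
  fixes h K :: "real \<Rightarrow> real"
  assumes h: "integrable lborel h" "\<And>x. h (- x) = - h x"
    and K: "\<And>x. K (- x) = 1 - K x"
    and int: "integrable lborel (\<lambda>x. h x * K (x - \<beta>))"
  shows "(\<integral>x. h x * K (x + \<beta>) \<partial>lborel) = (\<integral>x. h x * K (x - \<beta>) \<partial>lborel)"
proof -
  have "(\<integral>x. h x \<partial>lborel) = 0"
    using integral_reflect[of h] h(2) by simp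
  have "(\<integral>x. h x * K (x + \<beta>) \<partial>lborel) = (\<integral>x. h (- x) * K (- x + \<beta>) \<partial>lborel)"
    by (rule integral_reflect[symmetric])
  also have "\<dots> = (\<integral>x. h x * K (x - \<beta>) - h x \<partial>lborel)"
  proof (rule Bochner_Integration.integral_cong)
    have "K (- x + \<beta>) = 1 - K (x - \<beta>)" for x
      using K[of "x - \<beta>"] by simp
    then show "h (- x) * K (- x + \<beta>) = h x * K (x - \<beta>) - h x" for x
      by (simp add: h(2) right_diff_distrib)
  qed simp
  also have "\<dots> = (\<integral>x. h x * K (x - \<beta>) \<partial>lborel)"
    using h(1) int \<open>(\<integral>x. h x \<partial>lborel) = 0\<close> by simp
  finally show ?thesis .
qed

theorem theorem1:
  fixes f \<pi>\<^sub>0 :: "real \<Rightarrow> real" and \<sigma> \<mu> \<tau> :: real and \<pi> :: "real measure"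
  assumes "symmetric_density f" and "\<sigma> > 0"
    and "symmetric_density \<pi>\<^sub>0" and "\<tau> > 0"
    and "\<pi> = location_scale \<pi>\<^sub>0 \<mu> \<tau>"
    and "integrable \<pi> (\<lambda>\<Delta>. \<Delta>)" and "(\<integral>\<Delta>. \<Delta> \<partial>\<pi>) = 0"
  shows "critical_point (\<lambda>\<beta>. bayes_risk f \<sigma> \<pi> (threshold_rule \<beta>)) 0 \<and>
         (bounded (range f) \<longrightarrow>
           ((\<lambda>\<beta>. bayes_risk f \<sigma> \<pi> (threshold_rule \<beta>)) has_real_derivative 0) (at 0))"
proof -
  note f = assms(1) and p = assms(3)
  have \<mu>: "\<mu> = 0"
    using expectation_location_scale[of \<pi>\<^sub>0 \<tau> \<mu>] assms by simp
  define h where "h x = - (1 / \<tau> * \<pi>\<^sub>0 (x / \<tau>) * x)" for x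
  define K where "K y = cdf (location_scale f 0 1) (y / \<sigma>)" for y
  have [measurable]: "cdf (location_scale f 0 1) \<in> borel_measurable borel"
    using f by (rule cdf_location_scale_measurable)
  have K_meas [measurable]: "K \<in> borel_measurable borel"
    unfolding K_def[abs_def] by measurable
  interpret prob_space "location_scale f 0 1"
    using f by (intro prob_space_location_scale) auto
  have K_bound: "\<bar>K y\<bar> \<le> 1" for y
    by (simp add: K_def cdf_def)
  have K_symmetric: "K (- y) = 1 - K y" for y
    using cdf_symmetric[OF f] by (simp add: K_def)
  have h_odd: "h (- x) = - h x" for x
    using p by (simp add: h_def symmetric_density_def)
  have h_int: "integrable lborel h"
  proof -
    have "integrable lborel (\<lambda>x. 1 / \<tau> * \<pi>\<^sub>0 ((x - \<mu>) / \<tau>) * x)"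
      using assms(6) unfolding assms(5)
      by (subst (asm) integral_location_scale(2)[OF p \<open>\<tau> > 0\<close>]) simp_all
    then show ?thesis
      unfolding h_def[abs_def] \<mu> diff_zero by (rule Bochner_Integration.integrable_minus)
  qed
  have hK_int: "integrable lborel (\<lambda>x. h x * K (x - \<beta>))" for \<beta>
  proof (rule Bochner_Integration.integrable_bound[OF h_int])
    note [measurable] = borel_measurable_integrable[OF h_int]
    show "(\<lambda>x. h x * K (x - \<beta>)) \<in> borel_measurable lborel" by measurable
    show "AE x in lborel. norm (h x * K (x - \<beta>)) \<le> norm (h x)"
      using K_bound by (auto simp: abs_mult intro!: mult_left_le)
  qed
  have even: "(\<integral>x. h x * K (x + \<beta>) \<partial>lborel) = (\<integral>x. h x * K (x - \<beta>) \<partial>lborel)" for \<beta>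
    using h_int h_odd K_symmetric hK_int by (rule integral_odd_mult_symmetric_reflect)
  have risk: "bayes_risk f \<sigma> \<pi> (threshold_rule \<beta>) = (\<integral>x. h x * K (x - \<beta>) \<partial>lborel)" for \<beta>
  proof -
    have "bayes_risk f \<sigma> \<pi> (threshold_rule \<beta>) = (\<integral>x. - x * K (x - \<beta>) \<partial>\<pi>)"
      using assms by (simp add: bayes_risk_threshold_rule K_def)
    also have "\<dots> = (\<integral>x. 1 / \<tau> * \<pi>\<^sub>0 ((x - \<mu>) / \<tau>) * (- x * K (x - \<beta>)) \<partial>lborel)"
      unfolding assms(5) by (rule integral_location_scale[OF p \<open>\<tau> > 0\<close>]) measurable
    also have "\<dots> = (\<integral>x. h x * K (x - \<beta>) \<partial>lborel)"
      by (simp add: h_def \<mu> mult_ac)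
    finally show ?thesis .
  qed
  have "critical_point (\<lambda>\<beta>. bayes_risk f \<sigma> \<pi> (threshold_rule \<beta>)) 0"
    unfolding risk by (rule critical_point_even) (simp add: even)
  moreover have "((\<lambda>\<beta>. bayes_risk f \<sigma> \<pi> (threshold_rule \<beta>)) has_real_derivative 0) (at 0)"
    if "bounded (range f)"
  proof -
    from that obtain M where "\<And>x. \<bar>f x\<bar> \<le> M"
      by (auto simp: bounded_iff)
    then have M: "f x \<le> M" for x
      using abs_le_D1 by blast
    have lipschitz: "\<bar>K x - K y\<bar> \<le> M / \<sigma> * \<bar>x - y\<bar>" for x y
      using cdf_lipschitz[OF f M, of "x / \<sigma>" "y / \<sigma>"] \<open>\<sigma> > 0\<close>
      by (simp add: K_def flip: diff_divide_distrib)
    show ?thesis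
      unfolding risk using h_int K_meas K_bound lipschitz even
      by (rule even_convolution_derivative_0)
  qed
  ultimately show ?thesis by blast
qed

end
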